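(* Let $\mathcal{L}=\langle S, Act_\tau,\to\rangle$ be a finite-branching labelled transition system of processes. Then for every formula $\phi\in\mathrm{mayHML}$ there exists a test $t$ (a closed term of the test language) such that $\phi$ may-represents $t$; that is, for every $p\in S$, $p\ \mathbf{may\ satisfy}\ t$ if and only if $p\in[\![\phi]\!]$.
   Context: **Labelled transition systems.** An LTS over a countable set $Act$ of external actions is a triple $\langle S,Act_\tau,\to\rangle$ with $S$ a countable set of states (processes), $Act_\tau=Act\cup\{\tau\}$ where $\tau\notin Act$, and $\to\subseteq S\times Act_\tau\times S$; write $s\xrightarrow{\alpha}s'$ for $(s,\alpha,s')\in\to$, and $s\xrightarrow{\alpha}$ if such an $s'$ exists. The letter $a$ ranges over $Act$, $\alpha$ over $Act_\tau$. $\mathrm{Succ}(s)=\{s' : s\xrightarrow{\alpha}s'\text{ for some }\alpha\in Act_\tau\}$; the LTS is finite branching if $\mathrm{Succ}(s)$ is finite for all $s\in S$. Weak transitions: $\stackrel{\tau}{\Rightarrow}$ is the reflexive transitive closure of $\xrightarrow{\tau}$, and $s\stackrel{a}{\Rightarrow}s'$ means $s\stackrel{\tau}{\Rightarrow}s''\xrightarrow{a}s'''\stackrel{\tau}{\Rightarrow}s'$ for some $s'',s'''$. **The language mayHML.** It is the set of closed formulae generated by $\phi ::= \mathtt{tt}\mid\mathtt{ff}\mid X\mid\langle\alpha\rangle\phi\mid\phi_1\vee\phi_2\mid \min(X,\phi)$, where $X$ ranges over a countable set $Var$ of variables, $\alpha\in Act_\tau$, and $\min(X,\cdot)$ binds $X$.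 Given an environment $\rho:Var\to 2^S$: $[\![\mathtt{tt}]\!]\rho=S$; $[\![\mathtt{ff}]\!]\rho=\emptyset$; $[\![X]\!]\rho=\rho(X)$; $[\![\langle\alpha\rangle\phi]\!]\rho=\{s : s\stackrel{\alpha}{\Rightarrow}s'\text{ for some }s'\in[\![\phi]\!]\rho\}$; $[\![\phi_1\vee\phi_2]\!]\rho=[\![\phi_1]\!]\rho\cup[\![\phi_2]\!]\rho$; $[\![\min(X,\phi)]\!]\rho=\bigcap\{P\subseteq S : [\![\phi]\!]\rho[X\mapsto P]\subseteq P\}$. For closed $\phi$ the environment is omitted. **Tests.** Let $\omega\notin Act_\tau$. Tests are the closed terms of $t::=0\mid\alpha.t\mid\omega.0\mid X\mid t_1+t_2\mid\mu X.t$ ($\alpha\in Act_\tau$, $\mu X$ binds $X$), with transitions given by the rules: $\alpha.t\xrightarrow{\alpha}t$ for $\alpha\in Act_\tau\cup\{\omega\}$; if $t_i\xrightarrow{\alpha}t'$ for $i=1$ or $i=2$ then $t_1+t_2\xrightarrow{\alpha}t'$; $\mu X.t\xrightarrow{\tau}t\{\mu X.t/X\}$. **Testing.** For a process $p$ and test $t$, the experiment $p\,|\,t$ has only $\tau$-moves: $p|t\to p'|t$ if $p\xrightarrow{\tau}p'$; $p|t\to p|t'$ if $t\xrightarrow{\tau}t'$; $p|t\to p'|t'$ if $p\xrightarrow{a}p'$ and $t\xrightarrow{a}t'$ for some $a\in Act$. A computation of $p|t$ is a maximal (finite or infinite) path $p|t\to p_1|t_1\to\cdots$ (with $p_0=p$,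 $t_0=t$); it is successful if $t_n\xrightarrow{\omega}$ for some $n\ge0$. $p\ \mathbf{may\ satisfy}\ t$ if there exists a successful computation of $p|t$. *)

theory Defs
  imports Main "HOL-Library.Countable_Set" "HOL-Library.Extended_Nat"
begin

section \<open>Labelled transition systems\<close>

datatype 'a act = Tau | Ext 'a

definition Act_tau :: "'a set \<Rightarrow> 'a act set" where
  "Act_tau Act = insert Tau (Ext ` Act)"

type_synonym ('s, 'a) transitions = "('s \<times> 'a act \<times> 's) set"

definition step :: "('s, 'a) transitions \<Rightarrow> 'a act \<Rightarrow> ('s \<times> 's) set" where
  "step T \<alpha> = {(s, s'). (s, \<alpha>, s') \<in> T}"

definition succs :: "('s, 'a) transitions \<Rightarrow> 's \<Rightarrow> 's set" where
  "succs T s = {s'. \<exists>\<alpha>. (s, \<alpha>, s') \<in> T}"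

primrec weak :: "('s, 'a) transitions \<Rightarrow> 'a act \<Rightarrow> ('s \<times> 's) set" where
  "weak T Tau = (step T Tau)\<^sup>*"
| "weak T (Ext a) = (step T Tau)\<^sup>* O step T (Ext a) O (step T Tau)\<^sup>*"

locale lts =
  fixes S :: "'s set" and Act :: "'a set" and T :: "('s, 'a) transitions"
  assumes countable_states: "countable S"
    and countable_actions: "countable Act"
    and transitions: "T \<subseteq> S \<times> Act_tau Act \<times> S"

locale finite_branching_lts = lts +
  assumes finite_branching: "s \<in> S \<Longrightarrow> finite (succs T s)"

section \<open>The language mayHML\<close>

datatype (form_acts: 'a, 'v) form =
    TT
  | FF
  | FVar 'v
  | Dia "'a act" "('a, 'v) form"
  | FOr "('a, 'v) form" "('a, 'v) form"
  | FMin 'v "('a, 'v) form"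

primrec form_fv :: "('a, 'v) form \<Rightarrow> 'v set" where
  "form_fv TT = {}"
| "form_fv FF = {}"
| "form_fv (FVar X) = {X}"
| "form_fv (Dia \<alpha> \<phi>) = form_fv \<phi>"
| "form_fv (FOr \<phi>1 \<phi>2) = form_fv \<phi>1 \<union> form_fv \<phi>2"
| "form_fv (FMin X \<phi>) = form_fv \<phi> - {X}"

text \<open>The set function \<^const>\<open>form_acts\<close> of the datatype collects the external actions
  of a formula, so the condition on it says that all modalities are labelled in
  \<^term>\<open>Act_tau Act\<close>.\<close>

definition mayHML :: "'a set \<Rightarrow> ('a, 'v) form set" where
  "mayHML Act = {\<phi>. form_acts \<phi> \<subseteq> Act \<and> form_fv \<phi> = {}}"

primrec sem :: "'s set \<Rightarrow> ('s, 'a) transitions \<Rightarrow> ('a, 'v) form \<Rightarrow> ('v \<Rightarrow> 's set) \<Rightarrow> 's set" where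
  "sem S T TT \<rho> = S"
| "sem S T FF \<rho> = {}"
| "sem S T (FVar X) \<rho> = \<rho> X"
| "sem S T (Dia \<alpha> \<phi>) \<rho> = {s \<in> S. \<exists>s' \<in> sem S T \<phi> \<rho>. (s, s') \<in> weak T \<alpha>}"
| "sem S T (FOr \<phi>1 \<phi>2) \<rho> = sem S T \<phi>1 \<rho> \<union> sem S T \<phi>2 \<rho>"
| "sem S T (FMin X \<phi>) \<rho> = \<Inter>{P. P \<subseteq> S \<and> sem S T \<phi> (\<rho>(X := P)) \<subseteq> P}"

definition closed_sem :: "'s set \<Rightarrow> ('s, 'a) transitions \<Rightarrow> ('a, 'v) form \<Rightarrow> 's set" where
  "closed_sem S T \<phi> = sem S T \<phi> (\<lambda>_. {})"

lemma sem_cong_fv: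
  "(\<And>X. X \<in> form_fv \<phi> \<Longrightarrow> \<rho> X = \<rho>' X) \<Longrightarrow> sem S T \<phi> \<rho> = sem S T \<phi> \<rho>'"
proof (induction \<phi> arbitrary: \<rho> \<rho>')
  case (Dia \<alpha> \<phi>)
  have "sem S T \<phi> \<rho> = sem S T \<phi> \<rho>'"
    by (rule Dia.IH) (simp add: Dia.prems)
  then show ?case by simp
next
  case (FOr \<phi>1 \<phi>2)
  have "sem S T \<phi>1 \<rho> = sem S T \<phi>1 \<rho>'" "sem S T \<phi>2 \<rho> = sem S T \<phi>2 \<rho>'"
    by (rule FOr.IH, simp add: FOr.prems)+
  then show ?case by simp
next
  case (FMin X \<phi>)
  have "sem S T \<phi> (\<rho>(X := P)) = sem S T \<phi> (\<rho>'(X := P))" for P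
    by (rule FMin.IH) (simp add: FMin.prems)
  then show ?case by simp
qed simp_all

lemma sem_closed:
  assumes "form_fv \<phi> = {}"
  shows "sem S T \<phi> \<rho> = closed_sem S T \<phi>"
  unfolding closed_sem_def by (rule sem_cong_fv) (simp add: assms)

section \<open>Tests\<close>

text \<open>The constructor \<open>Success\<close> is the test \<open>\<omega>.0\<close>.\<close>

datatype (test_acts: 'a, 'v) test =
    Zero
  | Prefix "'a act" "('a, 'v) test"
  | Success
  | TVar 'v
  | Plus "('a, 'v) test" "('a, 'v) test"
  | Mu 'v "('a, 'v) test"

primrec test_fv :: "('a, 'v) test \<Rightarrow> 'v set" where
  "test_fv Zero = {}"
| "test_fv (Prefix \<alpha> t) = test_fv t"
| "test_fv Success = {}"
| "test_fv (TVar X) = {X}"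
| "test_fv (Plus t1 t2) = test_fv t1 \<union> test_fv t2"
| "test_fv (Mu X t) = test_fv t - {X}"

definition tests :: "'a set \<Rightarrow> ('a, 'v) test set" where
  "tests Act = {t. test_acts t \<subseteq> Act \<and> test_fv t = {}}"

text \<open>\<open>test_subst X u t\<close> is \<open>t{u/X}\<close>. No renaming of bound variables is performed: only
  closed terms \<open>u\<close> are ever substituted when a closed term is unfolded, so there is no
  capture.\<close>

primrec test_subst :: "'v \<Rightarrow> ('a, 'v) test \<Rightarrow> ('a, 'v) test \<Rightarrow> ('a, 'v) test" where
  "test_subst X u Zero = Zero"
| "test_subst X u (Prefix \<alpha> t) = Prefix \<alpha> (test_subst X u t)"
| "test_subst X u Success = Success"
| "test_subst X u (TVar Y) = (if Y = X then u else TVar Y)"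
| "test_subst X u (Plus t1 t2) = Plus (test_subst X u t1) (test_subst X u t2)"
| "test_subst X u (Mu Y t) = Mu Y (if Y = X then t else test_subst X u t)"

datatype 'a label = Lab "'a act" | Omega

inductive test_step :: "('a, 'v) test \<Rightarrow> 'a label \<Rightarrow> ('a, 'v) test \<Rightarrow> bool" where
  prefix: "test_step (Prefix \<alpha> t) (Lab \<alpha>) t"
| success: "test_step Success Omega Zero"
| plus_left: "test_step t1 l t' \<Longrightarrow> test_step (Plus t1 t2) l t'"
| plus_right: "test_step t2 l t' \<Longrightarrow> test_step (Plus t1 t2) l t'"
| unfold: "test_step (Mu X t) (Lab Tau) (test_subst X (Mu X t) t)"

section \<open>May testing\<close>

inductive exp_step ::
  "('s, 'a) transitions \<Rightarrow> 's \<times> ('a, 'v) test \<Rightarrow> 's \<times> ('a, 'v) test \<Rightarrow> bool"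
  for T where
  process: "(p, Tau, p') \<in> T \<Longrightarrow> exp_step T (p, t) (p', t)"
| test: "test_step t (Lab Tau) t' \<Longrightarrow> exp_step T (p, t) (p, t')"
| sync: "(p, Ext a, p') \<in> T \<Longrightarrow> test_step t (Lab (Ext a)) t' \<Longrightarrow> exp_step T (p, t) (p', t')"

text \<open>A computation is a sequence \<open>c\<close> of configurations together with its number of steps
  \<open>N\<close>, which is \<open>\<infinity>\<close> for infinite computations; the entries of \<open>c\<close> beyond \<open>N\<close> are irrelevant.
  The last conjunct is maximality.\<close>

definition computation ::
  "('s, 'a) transitions \<Rightarrow> 's \<Rightarrow> ('a, 'v) test \<Rightarrow> (nat \<Rightarrow> 's \<times> ('a, 'v) test) \<Rightarrow> enat \<Rightarrow> bool" where
  "computation T p t c N \<longleftrightarrow>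
     c 0 = (p, t) \<and>
     (\<forall>n. enat n < N \<longrightarrow> exp_step T (c n) (c (Suc n))) \<and>
     (\<forall>n. N = enat n \<longrightarrow> (\<nexists>e. exp_step T (c n) e))"

definition successful :: "(nat \<Rightarrow> 's \<times> ('a, 'v) test) \<Rightarrow> enat \<Rightarrow> bool" where
  "successful c N \<longleftrightarrow> (\<exists>n t'. enat n \<le> N \<and> test_step (snd (c n)) Omega t')"

definition may_satisfy :: "('s, 'a) transitions \<Rightarrow> 's \<Rightarrow> ('a, 'v) test \<Rightarrow> bool" where
  "may_satisfy T p t \<longleftrightarrow> (\<exists>c N. computation T p t c N \<and> successful c N)"

definition may_represents ::
  "'s set \<Rightarrow> ('s, 'a) transitions \<Rightarrow> ('a, 'v) form \<Rightarrow> ('a, 'v) test \<Rightarrow> bool" where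
  "may_represents S T \<phi> t \<longleftrightarrow> (\<forall>p \<in> S. may_satisfy T p t \<longleftrightarrow> p \<in> closed_sem S T \<phi>)"

end

(*  The formula is translated clause by clause, with min becoming mu, and "p may satisfy t" is
    reachability of a success state from p | t.  Reachability respects all the clauses, so the
    states that may satisfy mu X. t form a prefixed point of the body of min.  That they lie in
    every other prefixed point P follows by induction on the number of steps to success:
    unfolding the recursion costs one step, so the recursive calls of a run that succeeds
    within n steps already lie in P.  *)

theory Submission
  imports Defs
begin

subsection \<open>Success within a bounded number of steps\<close>

text \<open>\<open>n\<close> is an upper bound rather than an exact length, since \<open>now\<close>
  accepts every \<open>n\<close>. Bounds can therefore be weakened freely, and they serve as the
  induction measure for recursive tests.\<close>

inductive succeeds_within ::
  "('s, 'a) transitions \<Rightarrow> nat \<Rightarrow> 's \<times> ('a, 'v) test \<Rightarrow> bool"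
  for T where
  now: "test_step (snd c) Omega t' \<Longrightarrow> succeeds_within T n c"
| later: "exp_step T c d \<Longrightarrow> succeeds_within T n d \<Longrightarrow> succeeds_within T (Suc n) c"

lemma succeeds_within_now: "test_step t Omega t' \<Longrightarrow> succeeds_within T n (p, t)"
  by (rule now) simp

lemma succeeds_within_Suc: "succeeds_within T n c \<Longrightarrow> succeeds_within T (Suc n) c"
  by (induction rule: succeeds_within.induct) (auto intro: succeeds_within.intros)

text \<open>Needed because computations are maximal: a configuration that already succeeds must
  still be continued to a maximal path.\<close>

lemma computation_exists: "\<exists>c N. computation T p t c N"
proof -
  define f where "f e = (SOME e'. exp_step T e e')" for e :: "'a \<times> ('b, 'c) test"
  define c where "c n = (f ^^ n) (p, t)" for n
  have move: "exp_step T (c n) (c (Suc n))" if "\<exists>e. exp_step T (c n) e" for n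
    using someI_ex[OF that] by (simp add: c_def f_def)
  have c0: "c 0 = (p, t)"
    by (simp add: c_def)
  show ?thesis
  proof (cases "\<exists>n. \<nexists>e. exp_step T (c n) e")
    case True
    \<comment> \<open>The path is cut at its first stuck configuration. Beyond it, \<open>f\<close>
      returns arbitrary values.\<close>
    define N where "N = (LEAST n. \<nexists>e. exp_step T (c n) e)"
    have "\<nexists>e. exp_step T (c N) e"
      unfolding N_def by (rule LeastI_ex[OF True])
    moreover have "exp_step T (c n) (c (Suc n))" if "n < N" for n
      using move not_less_Least[of n] that unfolding N_def by blast
    ultimately have "computation T p t c (enat N)"
      using c0 by (simp add: computation_def)
    then show ?thesis by blast
  next
    case False
    then have "computation T p t c \<infinity>"
      using c0 move by (simp add: computation_def)
    then show ?thesis by blast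
  qed
qed

text \<open>\<open>case_nat\<close> shifts the path by one index, and \<open>eSuc\<close> fixes
  \<infinity>, so finite and infinite computations are treated alike.\<close>

lemma computation_Cons:
  assumes "exp_step T (p, t) (p', t')" and "computation T p' t' c N"
  shows "computation T p t (case_nat (p, t) c) (eSuc N)"
  unfolding computation_def
proof (intro conjI allI impI)
  fix n
  show "exp_step T (case_nat (p, t) c n) (case_nat (p, t) c (Suc n))" if "enat n < eSuc N"
    using assms that by (cases n) (auto simp: computation_def simp flip: eSuc_enat)
  show "\<nexists>e. exp_step T (case_nat (p, t) c n) e" if "eSuc N = enat n"
    using assms that by (cases n) (auto simp: computation_def zero_enat_def[symmetric] simp flip: eSuc_enat)
qed simp

lemma successful_Cons: "successful c N \<Longrightarrow> successful (case_nat e c) (eSuc N)"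
  unfolding successful_def by (metis eSuc_enat eSuc_ile_mono nat.case(2))

lemma succeeds_within_imp_may_satisfy: "succeeds_within T n (p, t) \<Longrightarrow> may_satisfy T p t"
proof (induction n "(p, t)" arbitrary: p t rule: succeeds_within.induct)
  case (now t' n p t)
  from computation_exists[of T p t] obtain c N where c: "computation T p t c N"
    by blast
  then have "successful c N"
    using now by (auto simp: successful_def computation_def zero_enat_def[symmetric] intro!: exI[of _ 0])
  with c show ?case
    unfolding may_satisfy_def by blast
next
  case (later d n p t)
  obtain p' t' where "d = (p', t')" by fastforce
  with later show ?case
    unfolding may_satisfy_def by (blast intro: computation_Cons successful_Cons)
qed

lemma may_satisfy_iff: "may_satisfy T p t \<longleftrightarrow> (\<exists>n. succeeds_within T n (p, t))"
proof
  assume "may_satisfy T p t"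
  then obtain c N n t' where c: "computation T p t c N" and n: "enat n \<le> N"
    and omega: "test_step (snd (c n)) Omega t'"
    unfolding may_satisfy_def successful_def by blast
  \<comment> \<open>Counts backwards from the success at index \<open>n\<close>, so that each
    induction step adds one move in front, as \<open>later\<close> does.\<close>
  have "succeeds_within T k (c (n - k))" if "k \<le> n" for k
    using that
  proof (induction k)
    case 0
    then show ?case using omega by (auto intro: now)
  next
    case (Suc k)
    have "enat (n - Suc k) < enat n" using Suc.prems by simp
    also note n
    finally have "exp_step T (c (n - Suc k)) (c (Suc (n - Suc k)))"
      using c by (simp add: computation_def)
    then have "exp_step T (c (n - Suc k)) (c (n - k))"
      using Suc.prems by (simp add: Suc_diff_Suc)
    with Suc show ?case by (auto intro: later)
  qed
  from this[of n] show "\<exists>n. succeeds_within T n (p, t)"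
    using c by (auto simp: computation_def)
qed (blast intro: succeeds_within_imp_may_satisfy)

lemma may_satisfy_step:
  "exp_step T (p, t) (p', t') \<Longrightarrow> may_satisfy T p' t' \<Longrightarrow> may_satisfy T p t"
  unfolding may_satisfy_iff by (blast intro: later)

lemma may_satisfy_tau:
  assumes "(p, p') \<in> (step T Tau)\<^sup>*" and "may_satisfy T p' t"
  shows "may_satisfy T p t"
  using assms
  by (induction rule: converse_rtrancl_induct)
    (auto simp: step_def intro: may_satisfy_step exp_step.process)


subsection \<open>May testing of compound tests\<close>

inductive_cases test_step_elims:
  "test_step Zero l t'" "test_step (Prefix \<alpha> t) l t'" "test_step Success l t'"
  "test_step (Plus t1 t2) l t'" "test_step (Mu X t) l t'"

inductive_cases exp_step_elim [consumes 1, case_names process test sync]: "exp_step T (p, t) d"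

lemma not_succeeds_within_Zero: "\<not> succeeds_within T n (p, Zero)"
proof
  assume "succeeds_within T n (p, Zero :: ('b, 'c) test)"
  then show False
    by (induction n "(p, Zero :: ('b, 'c) test)" arbitrary: p rule: succeeds_within.induct)
      (auto elim!: exp_step_elim test_step_elims)
qed

lemma weak_step: "(p, Tau, p') \<in> T \<Longrightarrow> (p', q) \<in> weak T \<alpha> \<Longrightarrow> (p, q) \<in> weak T \<alpha>"
  by (cases \<alpha>) (auto simp: step_def intro: converse_rtrancl_into_rtrancl)

text \<open>Until the prefix fires, only the process moves, by \<open>Tau\<close>. These moves and
  the firing step form a weak transition. Its trailing \<open>Tau\<close> part can be taken empty,
  as later moves belong to the run from \<open>p'\<close>.\<close>

lemma succeeds_within_Prefix:
  "succeeds_within T n (p, Prefix \<alpha> t) \<Longrightarrow>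
    \<exists>p'. (p, p') \<in> weak T \<alpha> \<and> succeeds_within T n (p', t)"
proof (induction n "(p, Prefix \<alpha> t)" arbitrary: p rule: succeeds_within.induct)
  case now
  then show ?case by (auto elim: test_step_elims)
next
  case (later d n p)
  from later.hyps(1) show ?case
  proof (cases rule: exp_step_elim)
    case (process p')
    with later.hyps(3) show ?thesis
      by (blast intro: weak_step succeeds_within_Suc)
  next
    case (test t')
    then have "\<alpha> = Tau" "t' = t" by (auto elim: test_step_elims)
    with test later.hyps(2) show ?thesis
      by (auto intro: succeeds_within_Suc)
  next
    case (sync a p' t')
    then have "\<alpha> = Ext a" "t' = t" by (auto elim: test_step_elims)
    moreover from this sync have "(p, p') \<in> weak T \<alpha>"
      by (auto simp: step_def)
    ultimately show ?thesis
      using sync later.hyps(2) by (blast intro: succeeds_within_Suc)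
  qed
qed

lemma may_satisfy_Prefix:
  assumes "(p, p') \<in> weak T \<alpha>" and "may_satisfy T p' t"
  shows "may_satisfy T p (Prefix \<alpha> t)"
proof (cases \<alpha>)
  case Tau
  then show ?thesis
    using assms by (auto intro: may_satisfy_tau may_satisfy_step exp_step.test test_step.prefix)
next
  case (Ext a)
  then obtain p1 p2 where 1: "(p, p1) \<in> (step T Tau)\<^sup>*" and 2: "(p1, Ext a, p2) \<in> T"
    and 3: "(p2, p') \<in> (step T Tau)\<^sup>*"
    using assms(1) by (auto simp: step_def)
  have "exp_step T (p1, Prefix \<alpha> t) (p2, t)"
    using 2 Ext by (auto intro: exp_step.sync test_step.prefix)
  then show ?thesis
    using 1 3 assms(2) by (blast intro: may_satisfy_tau may_satisfy_step)
qed

text \<open>Moves of the process alone leave the choice open, while every move of the test comes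
  from one summand and resolves it. So a run of the sum is a run of a summand of the same
  length.\<close>

lemma succeeds_within_Plus_iff:
  "succeeds_within T n (p, Plus t1 t2) \<longleftrightarrow>
    succeeds_within T n (p, t1) \<or> succeeds_within T n (p, t2)"
proof
  show "succeeds_within T n (p, t1) \<or> succeeds_within T n (p, t2)"
    if "succeeds_within T n (p, Plus t1 t2)"
    using that
  proof (induction n "(p, Plus t1 t2)" arbitrary: p rule: succeeds_within.induct)
    case now
    then show ?case
      by (auto elim!: test_step_elims intro: succeeds_within_now)
  next
    case (later d n p)
    from later.hyps(1) show ?case
      by (cases rule: exp_step_elim)
        (use later.hyps in \<open>blast elim: test_step_elims
           intro: succeeds_within.later exp_step.intros\<close>)+
  qed
  have "succeeds_within T n (p, Plus t1 t2)"
    if "succeeds_within T n (p, t)" and "t = t1 \<or> t = t2" for t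
    using that
  proof (induction n "(p, t)" arbitrary: p rule: succeeds_within.induct)
    case now
    then show ?case
      by (auto intro: succeeds_within_now test_step.plus_left test_step.plus_right)
  next
    case (later d n p)
    from later.hyps(1) show ?case
      by (cases rule: exp_step_elim)
        (use later in \<open>blast intro: succeeds_within.later exp_step.intros
           test_step.plus_left test_step.plus_right\<close>)+
  qed
  then show "succeeds_within T n (p, t1) \<or> succeeds_within T n (p, t2) \<Longrightarrow>
      succeeds_within T n (p, Plus t1 t2)"
    by blast
qed

text \<open>The only test move is the unfolding, and process moves made before it can be made after
  it instead. Dropping the unfolding makes the bound strictly smaller.\<close>

lemma succeeds_within_Mu:
  "succeeds_within T n (p, Mu X t) \<Longrightarrow>
    \<exists>m<n. succeeds_within T m (p, test_subst X (Mu X t) t)"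
proof (induction n "(p, Mu X t)" arbitrary: p rule: succeeds_within.induct)
  case now
  then show ?case by (auto elim: test_step_elims)
next
  case (later d n p)
  from later.hyps(1) show ?case
  proof (cases rule: exp_step_elim)
    case (process p')
    with later.hyps(3) obtain m where "m < n"
      and "succeeds_within T m (p', test_subst X (Mu X t) t)" by blast
    then show ?thesis
      using process by (blast intro: succeeds_within.later exp_step.process)
  qed (use later.hyps(2) in \<open>auto elim!: test_step_elims\<close>)
qed

lemma may_satisfy_Mu:
  "may_satisfy T p (test_subst X (Mu X t) t) \<Longrightarrow> may_satisfy T p (Mu X t)"
  by (rule may_satisfy_step[OF exp_step.test[OF test_step.unfold]])


subsection \<open>Translating formulae into tests\<close>

text \<open>Carrying an environment \<open>\<sigma>\<close> of tests makes the unfolding of \<open>\<mu>X\<close> an update of \<open>\<sigma>\<close>.\<close>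

primrec form_test :: "('a, 'v) form \<Rightarrow> ('v \<Rightarrow> ('a, 'v) test) \<Rightarrow> ('a, 'v) test" where
  "form_test TT \<sigma> = Success"
| "form_test FF \<sigma> = Zero"
| "form_test (FVar X) \<sigma> = \<sigma> X"
| "form_test (Dia \<alpha> \<phi>) \<sigma> = Prefix \<alpha> (form_test \<phi> \<sigma>)"
| "form_test (FOr \<phi>1 \<phi>2) \<sigma> = Plus (form_test \<phi>1 \<sigma>) (form_test \<phi>2 \<sigma>)"
| "form_test (FMin X \<phi>) \<sigma> = Mu X (form_test \<phi> (\<sigma>(X := TVar X)))"

lemma test_acts_form_test:
  "test_acts (form_test \<phi> \<sigma>) \<subseteq> form_acts \<phi> \<union> (\<Union>X. test_acts (\<sigma> X))"
proof (induction \<phi> arbitrary: \<sigma>)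
  case (FMin X \<phi>)
  then show ?case
    using FMin[of "\<sigma>(X := TVar X)"] by (fastforce split: if_splits)
next
  case (FOr \<phi>1 \<phi>2)
  show ?case
    using FOr[of \<sigma>] by auto
qed auto

lemma test_fv_form_test: "test_fv (form_test \<phi> \<sigma>) \<subseteq> (\<Union>X \<in> form_fv \<phi>. test_fv (\<sigma> X))"
proof (induction \<phi> arbitrary: \<sigma>)
  case (FMin X \<phi>)
  then show ?case
    using FMin[of "\<sigma>(X := TVar X)"] by (fastforce split: if_splits)
next
  case (FOr \<phi>1 \<phi>2)
  show ?case
    using FOr[of \<sigma>] by auto
qed auto

lemma test_subst_fresh: "X \<notin> test_fv t \<Longrightarrow> test_subst X u t = t"
  by (induction t) auto

text \<open>\<open>X\<close> occurs free in the translation only through \<open>\<sigma> X\<close>,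
  so replacing that placeholder by \<open>u\<close> is an update of the environment.\<close>

lemma test_subst_form_test:
  assumes "\<And>Y. Y \<noteq> X \<Longrightarrow> X \<notin> test_fv (\<sigma> Y)" and "\<sigma> X = TVar X"
  shows "test_subst X u (form_test \<phi> \<sigma>) = form_test \<phi> (\<sigma>(X := u))"
  using assms
proof (induction \<phi> arbitrary: \<sigma>)
  case (FMin Y \<phi>)
  show ?case
  proof (cases "Y = X")
    \<comment> \<open>For \<open>Y = X\<close> the inner binder shadows: the substitution stops
      there, and the translation overwrites the entry of \<open>X\<close> on both sides.\<close>
    case False
    then have "test_subst X u (form_test \<phi> (\<sigma>(Y := TVar Y))) =
        form_test \<phi> (\<sigma>(Y := TVar Y, X := u))"
      using FMin.prems by (intro FMin.IH) auto
    with False show ?thesis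
      by (simp add: fun_upd_twist[OF False] del: fun_upd_apply)
  qed (simp del: fun_upd_apply)
qed (auto simp: test_subst_fresh)

lemma form_test_FMin_unfold:
  fixes \<phi> :: "('a, 'v) form" and X :: 'v
  assumes "\<And>Y. test_fv (\<sigma> Y) = {}"
  defines "u \<equiv> form_test (FMin X \<phi>) \<sigma>"
  shows "test_subst X u (form_test \<phi> (\<sigma>(X := TVar X))) = form_test \<phi> (\<sigma>(X := u))"
    and "test_fv ((\<sigma>(X := u)) Y) = {}"
proof -
  show "test_subst X u (form_test \<phi> (\<sigma>(X := TVar X))) = form_test \<phi> (\<sigma>(X := u))"
    using assms(1) by (subst test_subst_form_test) auto
  have "test_fv u = {}"
    using test_fv_form_test[of "FMin X \<phi>" \<sigma>] assms(1) unfolding u_def by simp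
  then show "test_fv ((\<sigma>(X := u)) Y) = {}"
    using assms(1) by simp
qed

text \<open>The environments need to agree only on runs of at most \<open>n\<close> steps. This
  bounded hypothesis is what can be established for a recursion variable before the claim is known
  for longer runs.\<close>

lemma (in lts) succeeds_within_imp_sem:
  fixes \<phi> :: "('a, 'v) form"
  assumes "p \<in> S" and "succeeds_within T n (p, form_test \<phi> \<sigma>)" and "\<And>X. test_fv (\<sigma> X) = {}"
    and "\<And>X q m. m \<le> n \<Longrightarrow> q \<in> S \<Longrightarrow> succeeds_within T m (q, \<sigma> X) \<Longrightarrow> q \<in> \<rho> X"
  shows "p \<in> sem S T \<phi> \<rho>"
  using assms
proof (induction \<phi> arbitrary: p n \<sigma> \<rho>)
  case FF
  then show ?case by (simp add: not_succeeds_within_Zero)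
next
  case (Dia \<alpha> \<phi>)
  then obtain p' where p': "(p, p') \<in> weak T \<alpha>" "succeeds_within T n (p', form_test \<phi> \<sigma>)"
    using succeeds_within_Prefix[of T n p \<alpha> "form_test \<phi> \<sigma>"] by auto
  \<comment> \<open>The induction hypothesis applies only to states in \<open>S\<close>, so weak
    transitions must be seen to stay there.\<close>
  have target: "r \<in> S" if "(q, r) \<in> step T \<beta>" for q r \<beta>
    using that transitions by (auto simp: step_def)
  have tau: "r \<in> S" if "(q, r) \<in> (step T Tau)\<^sup>*" "q \<in> S" for q r
    using that by (induction rule: rtrancl_induct) (auto dest: target)
  have "p' \<in> S"
    using p'(1) \<open>p \<in> S\<close> by (cases \<alpha>) (auto dest: target tau)
  then have "p' \<in> sem S T \<phi> \<rho>"
    by (rule Dia.IH[OF _ p'(2) Dia.prems(3,4)])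
  with p'(1) \<open>p \<in> S\<close> show ?case by auto
next
  case (FOr \<phi>1 \<phi>2)
  from FOr.prems(2) consider "succeeds_within T n (p, form_test \<phi>1 \<sigma>)"
    | "succeeds_within T n (p, form_test \<phi>2 \<sigma>)"
    by (auto simp: succeeds_within_Plus_iff)
  then show ?case
  proof cases
    case 1
    have "p \<in> sem S T \<phi>1 \<rho>"
      by (rule FOr.IH(1)[OF FOr.prems(1) 1 FOr.prems(3,4)])
    then show ?thesis by simp
  next
    case 2
    have "p \<in> sem S T \<phi>2 \<rho>"
      by (rule FOr.IH(2)[OF FOr.prems(1) 2 FOr.prems(3,4)])
    then show ?thesis by simp
  qed
next
  case (FMin X \<phi>)
  define u where "u = form_test (FMin X \<phi>) \<sigma>"
  note unfold = form_test_FMin_unfold[of \<sigma> X \<phi>, OF FMin.prems(3), folded u_def]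
  \<comment> \<open>Inside the structural induction, a strong induction on the bound
    \<open>m\<close> for a fixed prefixed point \<open>P\<close>.\<close>
  have "q \<in> P"
    if P: "sem S T \<phi> (\<rho>(X := P)) \<subseteq> P" and "q \<in> S" "succeeds_within T m (q, u)" "m \<le> n"
    for P q m
    using that(2-)
  proof (induction m arbitrary: q rule: less_induct)
    case (less m)
    from less.prems(2) obtain k where k: "k < m"
        "succeeds_within T k (q, form_test \<phi> (\<sigma>(X := u)))"
      using succeeds_within_Mu unfold(1) unfolding u_def by fastforce
    have "q \<in> sem S T \<phi> (\<rho>(X := P))"
    proof (rule FMin.IH[OF less.prems(1) k(2) unfold(2)])
      fix Y r j
      \<comment> \<open>For \<open>X\<close> itself, \<open>j \<le> k < m\<close> gives access to
        the inner induction hypothesis. For other variables, \<open>j \<le> n\<close> gives access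
        to the assumption on \<open>\<rho>\<close>.\<close>
      assume "j \<le> k" "r \<in> S" "succeeds_within T j (r, (\<sigma>(X := u)) Y)"
      then show "r \<in> (\<rho>(X := P)) Y"
        using less.IH[of j r] less.prems(3) k(1) FMin.prems(4)[of j r Y]
        by (cases "Y = X") auto
    qed
    with P show ?case by blast
  qed
  with FMin.prems(1,2) show ?case
    by (auto simp: u_def)
next
  case (FVar X)
  then show ?case
    using FVar.prems(4)[of n p X] by simp
qed simp

lemma sem_imp_may_satisfy:
  fixes \<phi> :: "('a, 'v) form"
  assumes "\<And>X. test_fv (\<sigma> X) = {}" and "\<And>X. \<rho> X \<subseteq> {p \<in> S. may_satisfy T p (\<sigma> X)}"
  shows "sem S T \<phi> \<rho> \<subseteq> {p \<in> S. may_satisfy T p (form_test \<phi> \<sigma>)}"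
  using assms
proof (induction \<phi> arbitrary: \<sigma> \<rho>)
  case TT
  have "may_satisfy T p (Success :: ('a, 'v) test)" for p
    unfolding may_satisfy_iff by (blast intro: succeeds_within_now test_step.success)
  then show ?case by simp
next
  case (Dia \<alpha> \<phi>)
  from Dia.IH[of \<sigma> \<rho>, OF Dia.prems] show ?case
    by (auto intro: may_satisfy_Prefix)
next
  case (FOr \<phi>1 \<phi>2)
  from FOr.IH[of \<sigma> \<rho>, OF FOr.prems] show ?case
    by (auto simp: may_satisfy_iff succeeds_within_Plus_iff)
next
  case (FMin X \<phi>)
  define u where "u = form_test (FMin X \<phi>) \<sigma>"
  note unfold = form_test_FMin_unfold[of \<sigma> X \<phi>, OF FMin.prems(1), folded u_def]
  \<comment> \<open>This set is a prefixed point of the body, hence contains the intersection that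
    defines \<open>FMin\<close>.\<close>
  define P where "P = {p \<in> S. may_satisfy T p u}"
  have "sem S T \<phi> (\<rho>(X := P)) \<subseteq> {p \<in> S. may_satisfy T p (form_test \<phi> (\<sigma>(X := u)))}"
  proof (rule FMin.IH[of "\<sigma>(X := u)" "\<rho>(X := P)", OF unfold(2)])
    show "(\<rho>(X := P)) Y \<subseteq> {p \<in> S. may_satisfy T p ((\<sigma>(X := u)) Y)}" for Y
      using FMin.prems(2)[of Y] by (simp add: P_def)
  qed
  also have "\<dots> \<subseteq> P"
  proof -
    have "may_satisfy T p u" if "may_satisfy T p (form_test \<phi> (\<sigma>(X := u)))" for p
      unfolding u_def form_test.simps
      by (rule may_satisfy_Mu) (use that unfold(1) in \<open>simp only: u_def form_test.simps\<close>)
    then show ?thesis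
      unfolding P_def by blast
  qed
  finally have prefixed: "sem S T \<phi> (\<rho>(X := P)) \<subseteq> P" .
  have "P \<subseteq> S"
    by (simp add: P_def)
  with prefixed have "sem S T (FMin X \<phi>) \<rho> \<subseteq> P"
    unfolding sem.simps by (intro Inter_lower) simp
  then show ?case
    by (simp only: P_def u_def)
qed auto

theorem theorem5p1:
  fixes S :: "'s set" and Act :: "'a set" and T :: "('s, 'a) transitions"
    and \<phi> :: "('a, 'v::countable) form"
  assumes "finite_branching_lts S Act T"
    and "\<phi> \<in> mayHML Act"
  shows "\<exists>t :: ('a, 'v) test. t \<in> tests Act \<and> may_represents S T \<phi> t"
proof -
  interpret lts S Act T
    using assms(1) by (rule finite_branching_lts.axioms)
  \<comment> \<open>\<open>Zero\<close> is closed, contributes no actions and never succeeds, so it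
    matches the empty valuation in \<open>closed_sem\<close>.\<close>
  define t where "t = form_test \<phi> (\<lambda>_. Zero)"
  have "t \<in> tests Act"
    using assms(2) test_acts_form_test[of \<phi> "\<lambda>_. Zero"] test_fv_form_test[of \<phi> "\<lambda>_. Zero"]
    by (auto simp: t_def tests_def mayHML_def)
  moreover have "p \<in> closed_sem S T \<phi>" if "p \<in> S" "may_satisfy T p t" for p
    using that succeeds_within_imp_sem[of p _ \<phi> "\<lambda>_. Zero" "\<lambda>_. {}"]
    by (auto simp: t_def may_satisfy_iff closed_sem_def not_succeeds_within_Zero)
  moreover have "closed_sem S T \<phi> \<subseteq> {p \<in> S. may_satisfy T p t}"
    unfolding closed_sem_def t_def by (rule sem_imp_may_satisfy) auto
  ultimately have "t \<in> tests Act \<and> may_represents S T \<phi> t"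
    by (auto simp: may_represents_def)
  then show ?thesis ..
qed

end
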